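(* For all $n,j\in\mathbb{Z}$, $$\genfrac{\{}{\}}{0pt}{}{-j}{-n}_{\gamma}=(-1)^{n+j}\genfrac{[}{]}{0pt}{}{n}{j}_{1-\gamma}.$$
   Context: The symbols $\genfrac{[}{]}{0pt}{}{n}{j}_{\gamma}$ and $\genfrac{\{}{\}}{0pt}{}{n}{j}_{\gamma}$, for all $n,j\in\mathbb{Z}$, denote polynomials in $\gamma$ defined as follows (they extend to all integer indices the Jacobi-Stirling numbers of the first and second kinds, respectively). - $\genfrac{[}{]}{0pt}{}{n}{j}_{\gamma}$ ($n,j\in\mathbb{Z}$) is the unique collection of polynomials in $\gamma$ satisfying $\genfrac{[}{]}{0pt}{}{n}{0}_{\gamma}=\delta_{n,0}$ for all $n\in\mathbb{Z}$, $\genfrac{[}{]}{0pt}{}{0}{j}_{\gamma}=\delta_{j,0}$ for all $j\in\mathbb{Z}$, and $$\genfrac{[}{]}{0pt}{}{n}{j}_{\gamma}=\genfrac{[}{]}{0pt}{}{n-1}{j-1}_{\gamma}+(n-1)(n+2\gamma-2)\genfrac{[}{]}{0pt}{}{n-1}{j}_{\gamma}\qquad(n,j\in\mathbb{Z}).$$ - $\genfrac{\{}{\}}{0pt}{}{n}{j}_{\gamma}$ ($n,j\in\mathbb{Z}$) is the unique collection of polynomials in $\gamma$ satisfying $\genfrac{\{}{\}}{0pt}{}{n}{0}_{\gamma}=\delta_{n,0}$ for all $n\in\mathbb{Z}$, $\genfrac{\{}{\}}{0pt}{}{0}{j}_{\gamma}=\delta_{j,0}$ for all $j\in\mathbb{Z}$,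 and $$\genfrac{\{}{\}}{0pt}{}{n}{j}_{\gamma}=\genfrac{\{}{\}}{0pt}{}{n-1}{j-1}_{\gamma}+j(j+2\gamma-1)\genfrac{\{}{\}}{0pt}{}{n-1}{j}_{\gamma}\qquad(n,j\in\mathbb{Z}).$$ The subscript $1-\gamma$ means that $1-\gamma$ is substituted for $\gamma$ in the polynomial. *)

theory Defs
  imports "HOL-Computational_Algebra.Polynomial"
begin

(* The polynomial variable [:0, 1:] plays the role of gamma. *)

definition is_jacobi_stirling1 :: "(int \<Rightarrow> int \<Rightarrow> 'a::field_char_0 poly) \<Rightarrow> bool" where
  "is_jacobi_stirling1 c \<longleftrightarrow>
     (\<forall>n. c n 0 = (if n = 0 then 1 else 0)) \<and>
     (\<forall>j. c 0 j = (if j = 0 then 1 else 0)) \<and>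
     (\<forall>n j. c n j = c (n - 1) (j - 1) + of_int (n - 1) * (of_int n + 2 * [:0, 1:] - 2) * c (n - 1) j)"

definition is_jacobi_stirling2 :: "(int \<Rightarrow> int \<Rightarrow> 'a::field_char_0 poly) \<Rightarrow> bool" where
  "is_jacobi_stirling2 S \<longleftrightarrow>
     (\<forall>n. S n 0 = (if n = 0 then 1 else 0)) \<and>
     (\<forall>j. S 0 j = (if j = 0 then 1 else 0)) \<and>
     (\<forall>n j. S n j = S (n - 1) (j - 1) + of_int j * (of_int j + 2 * [:0, 1:] - 1) * S (n - 1) j)"

definition jacobi_stirling1 :: "int \<Rightarrow> int \<Rightarrow> 'a::field_char_0 poly" where
  "jacobi_stirling1 = (THE c. is_jacobi_stirling1 c)"

definition jacobi_stirling2 :: "int \<Rightarrow> int \<Rightarrow> 'a::field_char_0 poly" where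
  "jacobi_stirling2 = (THE S. is_jacobi_stirling2 S)"

(* The rest shows that both descriptions are met by exactly one collection of polynomials.
   Existence is proved by filling the quadrants n, j >= 0 and n, j <= 0 separately, each
   with an array of the following shape, and putting 0 elsewhere. *)

fun triangle :: "(nat \<Rightarrow> nat \<Rightarrow> 'r::comm_ring_1) \<Rightarrow> nat \<Rightarrow> nat \<Rightarrow> 'r" where
  "triangle v 0 0 = 1"
| "triangle v 0 (Suc k) = 0"
| "triangle v (Suc n) 0 = 0"
| "triangle v (Suc n) (Suc k) = triangle v n k + v n k * triangle v n (Suc k)"

lemma triangle_0_left: "triangle v 0 k = (if k = 0 then 1 else 0)"
  by (cases k) auto

lemma triangle_0_right: "triangle v n 0 = (if n = 0 then 1 else 0)"
  by (cases n) auto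

lemma triangular_recurrence_exists:
  fixes w :: "int \<Rightarrow> int \<Rightarrow> 'r::comm_ring_1"
  assumes w10: "w 1 0 = 0"
  shows "\<exists>X. (\<forall>n. X n 0 = (if n = 0 then 1 else 0)) \<and>
             (\<forall>j. X 0 j = (if j = 0 then 1 else 0)) \<and>
             (\<forall>n j. X n j = X (n - 1) (j - 1) + w n j * X (n - 1) j)"
proof -
  define P where "P = triangle (\<lambda>n k. w (int n + 1) (int k + 1))"
  define Q where "Q = triangle (\<lambda>k m. - w (- int m) (- int k))"
  define X where "X = (\<lambda>n j :: int. if n \<ge> 0 \<and> j \<ge> 0 then P (nat n) (nat j)
      else if n \<le> 0 \<and> j \<le> 0 then Q (nat (- j)) (nat (- n)) else 0)"
  have bd1: "X n 0 = (if n = 0 then 1 else 0)" for n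
    by (auto simp: X_def P_def Q_def triangle_0_left triangle_0_right)
  have bd2: "X 0 j = (if j = 0 then 1 else 0)" for j
    by (auto simp: X_def P_def Q_def triangle_0_left triangle_0_right)
  have Xneg: "X n j = Q (nat (- j)) (nat (- n))" if "n \<le> 0" "j \<le> 0" for n j
    using that by (auto simp: X_def P_def Q_def triangle_0_left triangle_0_right)
  have rec: "X n j = X (n - 1) (j - 1) + w n j * X (n - 1) j" for n j
  proof -
    consider (pos) "n \<ge> 1" "j \<ge> 1" | (neg) "n \<le> 0" "j \<le> 0"
      | (zero) "n \<ge> 1" "j = 0" | (mixed1) "n \<ge> 1" "j < 0" | (mixed2) "n \<le> 0" "j \<ge> 1"
      by linarith
    then show ?thesis
    proof cases
      case pos
      define a b where "a = nat (n - 1)" and "b = nat (j - 1)"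
      have nj: "n = int a + 1" "j = int b + 1" using pos by (auto simp: a_def b_def)
      have "nat (int a + 1) = Suc a" "nat (int b + 1) = Suc b" by auto
      then show ?thesis by (simp add: nj X_def P_def)
    next
      case neg
      define a b where "a = nat (- n)" and "b = nat (- j)"
      have nj: "n = - int a" "j = - int b" using neg by (auto simp: a_def b_def)
      have "nat (- (- int a - 1)) = Suc a" "nat (- (- int b - 1)) = Suc b" by auto
      then have "X (n - 1) (j - 1) = Q (Suc b) (Suc a)" "X (n - 1) j = Q b (Suc a)"
          "X n j = Q b a"
        using neg by (simp_all only: Xneg nj) (simp_all add: Xneg)
      moreover have "Q (Suc b) (Suc a) = Q b a - w n j * Q b (Suc a)"
        by (simp add: Q_def nj)
      ultimately show ?thesis by simp
    next
      case zero
      have "X (n - 1) (- 1) = 0" using zero by (cases "n = 1"; simp add: bd2; simp add: X_def)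
      moreover have "w n 0 * X (n - 1) 0 = 0" using w10 by (auto simp: bd1)
      ultimately show ?thesis using zero by (simp add: bd1)
    next
      case mixed1
      then show ?thesis by (cases "n = 1"; simp add: bd2; simp add: X_def)
    next
      case mixed2
      have "X n j = 0" "X (n - 1) j = 0" using mixed2 by (cases "n = 0"; simp add: bd2; simp add: X_def)+
      moreover have "X (n - 1) (j - 1) = 0"
        using mixed2 by (cases "j = 1"; simp add: bd1; simp add: X_def)
      ultimately show ?thesis by simp
    qed
  qed
  show ?thesis using bd1 bd2 rec by blast
qed

lemma triangular_recurrence_unique:
  fixes w :: "int \<Rightarrow> int \<Rightarrow> 'r::idom"
  assumes w_nz: "\<And>n j. n \<le> 0 \<Longrightarrow> j \<ge> 1 \<Longrightarrow> w n j \<noteq> 0"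
  assumes X0: "\<And>n. X n 0 = Y n 0" and X1: "\<And>j. X 0 j = Y 0 j"
  assumes rX: "\<And>n j. X n j = X (n - 1) (j - 1) + w n j * X (n - 1) j"
  assumes rY: "\<And>n j. Y n j = Y (n - 1) (j - 1) + w n j * Y (n - 1) j"
  shows "X n j = Y n j"
proof -
  have up: "X (int m) j = Y (int m) j" for m j
  proof (induction m arbitrary: j)
    case 0
    show ?case using X1 by simp
  next
    case (Suc m)
    show ?case using rX[of "int (Suc m)" j] rY[of "int (Suc m)" j] Suc by simp
  qed
  have down: "X (- int m) j = Y (- int m) j" for m j
  proof (induction m arbitrary: j)
    case 0
    show ?case using X1 by simp
  next
    case (Suc m)
    define r where "r = - int (Suc m)"
    have r: "- int m = r + 1" by (simp add: r_def)
    have IH: "X (r + 1) i = Y (r + 1) i" for i using Suc r by metis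
    have step: "X r (i - 1) + w (r + 1) i * X r i = Y r (i - 1) + w (r + 1) i * Y r i" for i
      using rX[of "r + 1" i] rY[of "r + 1" i] IH[of i] by simp
    have neg: "X r (- int k) = Y r (- int k)" for k
    proof (induction k)
      case (Suc k)
      have "- int (Suc k) = - int k - 1" by simp
      with step[of "- int k"] Suc show ?case by (metis add_right_cancel)
    qed (simp add: X0)
    have pos: "X r (int k) = Y r (int k)" for k
    proof (induction k)
      case (Suc k)
      have "w (r + 1) (int (Suc k)) \<noteq> 0" by (rule w_nz) (auto simp: r_def)
      moreover have "w (r + 1) (int (Suc k)) * X r (int (Suc k)) =
          w (r + 1) (int (Suc k)) * Y r (int (Suc k))"
        using step[of "int (Suc k)"] Suc by simp
      ultimately show ?case by simp
    qed (simp add: X0)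
    show ?case using neg pos by (metis r_def int_cases2)
  qed
  show ?thesis using up down by (metis int_cases2)
qed

lemma linear_poly_nonzero: "of_int a + 2 * [:0, 1:] - of_int b \<noteq> (0 :: 'a::field_char_0 poly)"
proof
  assume "of_int a + 2 * [:0, 1:] - of_int b = (0 :: 'a poly)"
  then have "coeff (of_int a + 2 * [:0, 1:] - of_int b :: 'a poly) 1 = 0" by simp
  then show False
    by (simp add: of_int_poly numeral_poly)
qed

lemma jacobi_stirling1_ex1:
  "\<exists>!c :: int \<Rightarrow> int \<Rightarrow> 'a::field_char_0 poly. is_jacobi_stirling1 c"
proof (rule ex_ex1I)
  show "\<exists>c :: int \<Rightarrow> int \<Rightarrow> 'a poly. is_jacobi_stirling1 c"
    unfolding is_jacobi_stirling1_def by (rule triangular_recurrence_exists) simp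
next
  fix X Y :: "int \<Rightarrow> int \<Rightarrow> 'a poly"
  assume XY: "is_jacobi_stirling1 X" "is_jacobi_stirling1 Y"
  have nz: "of_int (n - 1) * (of_int n + 2 * [:0, 1:] - 2) \<noteq> (0 :: 'a poly)" if "n \<le> 0" for n
    using that linear_poly_nonzero[of n 2, where 'a = 'a] by (simp del: of_int_diff)
  show "X = Y"
    by (intro ext, rule triangular_recurrence_unique[of
          "\<lambda>n j. of_int (n - 1) * (of_int n + 2 * [:0, 1:] - 2)"])
       (use XY nz in \<open>unfold is_jacobi_stirling1_def, metis+\<close>)
qed

lemma jacobi_stirling2_ex1:
  "\<exists>!S :: int \<Rightarrow> int \<Rightarrow> 'a::field_char_0 poly. is_jacobi_stirling2 S"
proof (rule ex_ex1I)
  show "\<exists>S :: int \<Rightarrow> int \<Rightarrow> 'a poly. is_jacobi_stirling2 S"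
    unfolding is_jacobi_stirling2_def by (rule triangular_recurrence_exists) simp
next
  fix X Y :: "int \<Rightarrow> int \<Rightarrow> 'a poly"
  assume XY: "is_jacobi_stirling2 X" "is_jacobi_stirling2 Y"
  have nz: "of_int j * (of_int j + 2 * [:0, 1:] - 1) \<noteq> (0 :: 'a poly)" if "j \<ge> 1" for j
    using that linear_poly_nonzero[of j 1, where 'a = 'a] by simp
  show "X = Y"
    by (intro ext, rule triangular_recurrence_unique[of
          "\<lambda>n j. of_int j * (of_int j + 2 * [:0, 1:] - 1)"])
       (use XY nz in \<open>unfold is_jacobi_stirling2_def, metis+\<close>)
qed

lemma is_jacobi_stirling1: "is_jacobi_stirling1 jacobi_stirling1"
  unfolding jacobi_stirling1_def by (rule theI'[OF jacobi_stirling1_ex1])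

lemma is_jacobi_stirling2: "is_jacobi_stirling2 jacobi_stirling2"
  unfolding jacobi_stirling2_def by (rule theI'[OF jacobi_stirling2_ex1])

end

theory Submission
  imports Defs
begin

text \<open>
  Both families are determined by their boundary values and their two-term recurrence, so the
  identity holds as soon as its right-hand side, read as a function of the indices on the left,
  obeys the second-kind rules. The boundary values are symmetric under \<open>(n, j) \<mapsto> (- j, - n)\<close>.
  That same reflection sends the three index pairs of the first-kind recurrence to those of the
  second-kind recurrence, only with the roles of left-hand side and first summand exchanged, so
  one has to solve for the other term. This flips the sign of the coefficient, and the factor
  \<open>(- 1) ^ (n + j)\<close> flips it back, since it takes opposite values at \<open>(n - 1, j)\<close> and at the other
  two pairs. What is left is that the coefficients agree, which is where
  the substitution of \<open>1 - \<gamma>\<close> for \<open>\<gamma>\<close> is needed (\<open>jacobi_stirling_weight_reflection\<close>).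
\<close>

definition reflected_jacobi_stirling1 :: "int \<Rightarrow> int \<Rightarrow> 'a::field_char_0 poly" where
  "reflected_jacobi_stirling1 n j =
     smult ((- 1) powi (- j + - n)) (pcompose (jacobi_stirling1 (- j) (- n)) [:1, - 1:])"

lemma pcompose_of_int: "pcompose (of_int k) p = (of_int k :: 'a::comm_ring_1 poly)"
  by (simp add: of_int_poly pcompose_const)

text \<open>
  The left-hand side is the weight of the first-kind recurrence at row \<open>1 - j\<close>, transformed, and
  the right-hand side that of the second-kind recurrence at column \<open>j\<close>. They agree because
  \<open>(1 - j) + 2 * (1 - \<gamma>) - 2 = - (j + 2 * \<gamma> - 1)\<close>, whose sign cancels that of \<open>- j\<close>.
\<close>
lemma jacobi_stirling_weight_reflection:
  "pcompose (of_int (- j) * (of_int (1 - j) + 2 * [:0, 1:] - 2)) [:1, - 1:]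
     = (of_int j * (of_int j + 2 * [:0, 1:] - 1) :: 'a::field_char_0 poly)"
proof -
  have two: "pcompose (2 :: 'a poly) [:1, - 1:] = 2"
    using pcompose_of_int[of 2 "[:1, - 1:] :: 'a poly"] by simp
  have var: "pcompose [:0, 1:] [:1, - 1:] = (1 - [:0, 1:] :: 'a poly)"
    by (simp add: pcompose_pCons one_pCons)
  have "pcompose (of_int (- j) * (of_int (1 - j) + 2 * [:0, 1:] - 2)) [:1, - 1:]
     = (of_int (- j) * (of_int (1 - j) + 2 * (1 - [:0, 1:]) - 2) :: 'a poly)"
    by (simp only: pcompose_mult pcompose_add pcompose_diff pcompose_of_int two var)
  also have "\<dots> = of_int j * (of_int j + 2 * [:0, 1:] - 1)"
  proof -
    have "of_int (- j) * (of_int (1 - j) + 2 * (1 - g) - 2) = of_int j * (of_int j + 2 * g - 1)"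
      for g :: "'a poly"
      by (simp add: algebra_simps)
    then show ?thesis .
  qed
  finally show ?thesis .
qed

lemma is_jacobi_stirling2_reflected_jacobi_stirling1:
  "is_jacobi_stirling2 (reflected_jacobi_stirling1 :: int \<Rightarrow> int \<Rightarrow> 'a::field_char_0 poly)"
proof -
  let ?T = "reflected_jacobi_stirling1 :: int \<Rightarrow> int \<Rightarrow> 'a poly"
  let ?c = "jacobi_stirling1 :: int \<Rightarrow> int \<Rightarrow> 'a poly"
  let ?s = "\<lambda>p :: 'a poly. pcompose p [:1, - 1:]"
  have c: "?c n 0 = (if n = 0 then 1 else 0)" "?c 0 j = (if j = 0 then 1 else 0)"
    "?c n j = ?c (n - 1) (j - 1) + of_int (n - 1) * (of_int n + 2 * [:0, 1:] - 2) * ?c (n - 1) j"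
    for n j
    using is_jacobi_stirling1[where 'a = 'a] unfolding is_jacobi_stirling1_def by blast+
  have rec: "?T n j = ?T (n - 1) (j - 1) + of_int j * (of_int j + 2 * [:0, 1:] - 1) * ?T (n - 1) j"
    for n j
  proof -
    let ?w = "of_int j * (of_int j + 2 * [:0, 1:] - 1) :: 'a poly"
    let ?e = "(- 1 :: 'a) powi (- j + - n)"
    have idx: "1 - i - 1 = - i" "- (i - 1) = 1 - i" for i :: int by simp_all
    have "?c (1 - j) (1 - n) = ?c (- j) (- n)
        + of_int (- j) * (of_int (1 - j) + 2 * [:0, 1:] - 2) * ?c (- j) (1 - n)"
      using c(3)[of "1 - j" "1 - n"] by (simp only: idx)
    then have crec: "?s (?c (1 - j) (1 - n)) = ?s (?c (- j) (- n)) + ?w * ?s (?c (- j) (1 - n))"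
      using jacobi_stirling_weight_reflection[of j, where 'a = 'a]
      by (simp only: pcompose_add pcompose_mult)
    have sign1: "(- 1 :: 'a) powi (- j + (1 - n)) = - ?e"
      using power_int_add_1[of "- 1 :: 'a" "- j + - n"] by (simp add: algebra_simps)
    have sign2: "(- 1 :: 'a) powi (1 - j + (1 - n)) = ?e"
      using power_int_add_1[of "- 1 :: 'a" "- j + (1 - n)"] sign1 by (simp add: algebra_simps)
    show ?thesis
      unfolding reflected_jacobi_stirling1_def idx sign1 sign2 crec
      by (simp add: smult_add_right)
  qed
  show ?thesis
    unfolding is_jacobi_stirling2_def
  proof (intro conjI allI)
    show "?T n 0 = (if n = 0 then 1 else 0)" for n
      by (simp add: reflected_jacobi_stirling1_def c(2) pcompose_1)
    show "?T 0 j = (if j = 0 then 1 else 0)" for j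
      by (simp add: reflected_jacobi_stirling1_def c(1) pcompose_1)
  qed (rule rec)
qed

theorem theorem5p2:
  fixes n j :: int
  shows "(jacobi_stirling2 (- j) (- n) :: 'a::field_char_0 poly)
    = smult ((- 1) powi (n + j)) (pcompose (jacobi_stirling1 n j) [:1, - 1:])"
proof -
  have "jacobi_stirling2 = (reflected_jacobi_stirling1 :: int \<Rightarrow> int \<Rightarrow> 'a poly)"
    using jacobi_stirling2_ex1 is_jacobi_stirling2 is_jacobi_stirling2_reflected_jacobi_stirling1
    by blast
  then show ?thesis
    by (simp add: reflected_jacobi_stirling1_def)
qed

end
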